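(* The proof system ${\bf K^\Delta}$ is strongly complete with respect to the class of filters, i.e. the class of all neighborhood frames possessing the properties $(m)$, $(c)$ and $(n)$.
   Context: Fix a nonempty set $\mathbf{P}$ of propositional variables. The language $\mathcal{L}(\Delta)$ is given by $\varphi::=p\in\mathbf{P}\mid\neg\varphi\mid\varphi\land\varphi\mid\Delta\varphi$; $\vee,\to,\leftrightarrow,\top$ are the usual abbreviations. A neighborhood frame is a pair $\langle S,N\rangle$ with $S$ a nonempty set and $N:S\to\mathcal{P}(\mathcal{P}(S))$; a neighborhood model $\mathcal{M}=\langle S,N,V\rangle$ adds a valuation $V$ assigning a set $V(p)\subseteq S$ to each $p\in\mathbf{P}$. Truth: $\mathcal{M},s\vDash p$ iff $s\in V(p)$; Boolean clauses as usual; $\mathcal{M},s\vDash\Delta\varphi$ iff $\varphi^{\mathcal{M}}\in N(s)$ or $S\setminus\varphi^{\mathcal{M}}\in N(s)$, where $\varphi^{\mathcal{M}}=\{s\in S\mid\mathcal{M},s\vDash\varphi\}$. Frame properties (required for every $s\in S$): $(m)$: $X\in N(s)$ and $X\subseteq Y\subseteq S$ imply $Y\in N(s)$; $(c)$: $X,Y\in N(s)$ implies $X\cap Y\in N(s)$; $(n)$: $S\in N(s)$. The system ${\bf K^\Delta}$ has as axiom schemas all instances of propositional tautologies (TAUT), $\Delta\text{Equ}$: $\Delta\varphi\leftrightarrow\Delta\neg\varphi$, $\Delta\text{M}$: $\Delta\varphi\to\Delta(\varphi\vee\psi)\vee\Delta(\neg\varphi\vee\chi)$, $\Delta\text{C}$: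 $\Delta\varphi\land\Delta\psi\to\Delta(\varphi\land\psi)$, and $\Delta\text{N}$: $\Delta\top$; its rules are MP (from $\varphi$ and $\varphi\to\psi$ infer $\psi$) and $\text{RE}\Delta$ (from $\varphi\leftrightarrow\psi$ infer $\Delta\varphi\leftrightarrow\Delta\psi$). A set $\Gamma$ of formulas is consistent in a system $\Lambda$ if there are no $\gamma_1,\dots,\gamma_n\in\Gamma$ such that $\neg(\gamma_1\land\dots\land\gamma_n)$ is a theorem of $\Lambda$. $\Lambda$ is strongly complete with respect to a class $\mathbb{K}$ of frames if every $\Lambda$-consistent set of formulas is satisfied (all members true) at some state of some model based on a frame in $\mathbb{K}$. *)

theory Defs
  imports Main
begin

text \<open>The nonempty set of propositional variables is the type \<open>'p\<close>.\<close>

datatype 'p fm =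
    Var 'p
  | Neg "'p fm"
  | And "'p fm" "'p fm"
  | Dlt "'p fm"

abbreviation Or :: "'p fm \<Rightarrow> 'p fm \<Rightarrow> 'p fm" where
  "Or \<phi> \<psi> \<equiv> Neg (And (Neg \<phi>) (Neg \<psi>))"

abbreviation Imp :: "'p fm \<Rightarrow> 'p fm \<Rightarrow> 'p fm" where
  "Imp \<phi> \<psi> \<equiv> Or (Neg \<phi>) \<psi>"

abbreviation Iff :: "'p fm \<Rightarrow> 'p fm \<Rightarrow> 'p fm" where
  "Iff \<phi> \<psi> \<equiv> And (Imp \<phi> \<psi>) (Imp \<psi> \<phi>)"

text \<open>Here \<open>undefined\<close> is just some fixed propositional variable.\<close>

abbreviation Top :: "'p fm" where
  "Top \<equiv> Or (Var undefined) (Neg (Var undefined))"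

type_synonym 's frame = "'s set \<times> ('s \<Rightarrow> 's set set)"

definition nbhd_frame :: "'s frame \<Rightarrow> bool" where
  "nbhd_frame = (\<lambda>(S, N). S \<noteq> {} \<and> (\<forall>s\<in>S. N s \<subseteq> Pow S))"

definition valuation_on :: "'s set \<Rightarrow> ('p \<Rightarrow> 's set) \<Rightarrow> bool" where
  "valuation_on S V \<longleftrightarrow> (\<forall>p. V p \<subseteq> S)"

fun sat :: "'s frame \<Rightarrow> ('p \<Rightarrow> 's set) \<Rightarrow> 's \<Rightarrow> 'p fm \<Rightarrow> bool" where
  "sat (S, N) V s (Var p) \<longleftrightarrow> s \<in> V p"
| "sat (S, N) V s (Neg \<phi>) \<longleftrightarrow> \<not> sat (S, N) V s \<phi>"
| "sat (S, N) V s (And \<phi> \<psi>) \<longleftrightarrow> sat (S, N) V s \<phi> \<and> sat (S, N) V s \<psi>"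
| "sat (S, N) V s (Dlt \<phi>) \<longleftrightarrow>
     {t \<in> S. sat (S, N) V t \<phi>} \<in> N s \<or> S - {t \<in> S. sat (S, N) V t \<phi>} \<in> N s"

definition prop_m :: "'s frame \<Rightarrow> bool" where
  "prop_m = (\<lambda>(S, N). \<forall>s\<in>S. \<forall>X Y. X \<in> N s \<and> X \<subseteq> Y \<and> Y \<subseteq> S \<longrightarrow> Y \<in> N s)"

definition prop_c :: "'s frame \<Rightarrow> bool" where
  "prop_c = (\<lambda>(S, N). \<forall>s\<in>S. \<forall>X Y. X \<in> N s \<and> Y \<in> N s \<longrightarrow> X \<inter> Y \<in> N s)"

definition prop_n :: "'s frame \<Rightarrow> bool" where
  "prop_n = (\<lambda>(S, N). \<forall>s\<in>S. S \<in> N s)"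

text \<open>The improper filter \<open>N s = Pow S\<close> is allowed.\<close>

definition filters :: "'s frame set" where
  "filters = {F. nbhd_frame F \<and> prop_m F \<and> prop_c F \<and> prop_n F}"

datatype pfm = PVar nat | PNeg pfm | PAnd pfm pfm

primrec peval :: "(nat \<Rightarrow> bool) \<Rightarrow> pfm \<Rightarrow> bool" where
  "peval v (PVar n) \<longleftrightarrow> v n"
| "peval v (PNeg \<alpha>) \<longleftrightarrow> \<not> peval v \<alpha>"
| "peval v (PAnd \<alpha> \<beta>) \<longleftrightarrow> peval v \<alpha> \<and> peval v \<beta>"

definition tautology :: "pfm \<Rightarrow> bool" where
  "tautology \<alpha> \<longleftrightarrow> (\<forall>v. peval v \<alpha>)"

primrec inst :: "(nat \<Rightarrow> 'p fm) \<Rightarrow> pfm \<Rightarrow> 'p fm" where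
  "inst \<sigma> (PVar n) = \<sigma> n"
| "inst \<sigma> (PNeg \<alpha>) = Neg (inst \<sigma> \<alpha>)"
| "inst \<sigma> (PAnd \<alpha> \<beta>) = And (inst \<sigma> \<alpha>) (inst \<sigma> \<beta>)"

inductive_set K_Delta :: "'p fm set" where
  TAUT: "tautology \<alpha> \<Longrightarrow> inst \<sigma> \<alpha> \<in> K_Delta"
| Equ: "Iff (Dlt \<phi>) (Dlt (Neg \<phi>)) \<in> K_Delta"
| M: "Imp (Dlt \<phi>) (Or (Dlt (Or \<phi> \<psi>)) (Dlt (Or (Neg \<phi>) \<chi>))) \<in> K_Delta"
| C: "Imp (And (Dlt \<phi>) (Dlt \<psi>)) (Dlt (And \<phi> \<psi>)) \<in> K_Delta"
| N: "Dlt Top \<in> K_Delta"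
| MP: "\<phi> \<in> K_Delta \<Longrightarrow> Imp \<phi> \<psi> \<in> K_Delta \<Longrightarrow> \<psi> \<in> K_Delta"
| RE: "Iff \<phi> \<psi> \<in> K_Delta \<Longrightarrow> Iff (Dlt \<phi>) (Dlt \<psi>) \<in> K_Delta"

text \<open>\<open>foldl And \<gamma> \<gamma>s\<close> is the conjunction of the nonempty list \<open>\<gamma> # \<gamma>s\<close>.\<close>

definition consistent :: "'p fm set \<Rightarrow> 'p fm set \<Rightarrow> bool" where
  "consistent \<Lambda> \<Gamma> \<longleftrightarrow>
     \<not> (\<exists>\<gamma> \<gamma>s. set (\<gamma> # \<gamma>s) \<subseteq> \<Gamma> \<and> Neg (foldl And \<gamma> \<gamma>s) \<in> \<Lambda>)"

text \<open>HOL has no existential quantification over types, so the states of the frames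
  range over the fixed type \<open>'s\<close>; since frames occur only existentially, fixing \<open>'s\<close>
  can only make the property stronger.\<close>

definition strongly_complete :: "'p fm set \<Rightarrow> 's frame set \<Rightarrow> bool" where
  "strongly_complete \<Lambda> \<K> \<longleftrightarrow>
     (\<forall>\<Gamma>. consistent \<Lambda> \<Gamma> \<longrightarrow>
        (\<exists>S N V s. (S, N) \<in> \<K> \<and> valuation_on S V \<and> s \<in> S \<and>
           (\<forall>\<gamma>\<in>\<Gamma>. sat (S, N) V s \<gamma>)))"

end

theory Submission imports Defs begin

text \<open>
  The proof is a canonical model construction. The states are the complete theories: sets that
  contain the logic, are closed under modus ponens, and contain exactly one of \<open>\<phi>\<close> and \<open>Neg \<phi>\<close>.

  The difficulty is that \<open>Dlt \<phi>\<close> only says that \<open>\<phi>\<close> or its negation is a neighborhood, without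
  saying which, so the set of all \<open>\<phi>\<close> with \<open>Dlt \<phi> \<in> T\<close> is closed under negation, and the filter it
  generates is improper. Non-contingency logic nevertheless defines something that behaves like necessity at \<open>T\<close>:
  call \<open>\<phi>\<close> settled positively if every weakening \<open>Or \<phi> \<psi>\<close> has \<open>Dlt (Or \<phi> \<psi>) \<in> T\<close>.
  By axiom C (after distributing \<open>Or\<close> over \<open>And\<close>), axiom N and rule RE, these
  formulas form a filter modulo provable equivalence (\<open>settled_And\<close>, \<open>settled_Top\<close>,
  \<open>settled_mono\<close>). Axiom M says exactly that \<open>Dlt \<phi>\<close> forces \<open>\<phi>\<close> or \<open>Neg \<phi>\<close> to be settled
  positively, and Equ gives the converse (\<open>Dlt_iff_settled\<close>).

  Hence let the neighborhoods of \<open>T\<close> be the supersets of the truth sets of formulas settled at \<open>T\<close>.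
  This is a filter, and since inclusion of truth sets is provable implication
  (\<open>truth_set_subset_iff\<close>, from Lindenbaum's lemma), closing upwards adds no new truth set
  (\<open>truth_set_in_nbhds_iff\<close>). The truth lemma follows by induction. The logic itself is
  consistent, since reading every \<open>Dlt \<phi>\<close> as true validates it; this is what provides a state in the case of the empty
  set of formulas.
\<close>

section \<open>Propositional reasoning\<close>

text \<open>Truth of a formula when variables and \<open>Dlt\<close>-formulas alike are treated as propositional atoms.
  Validity in this sense can be decided by the simplifier, whereas an explicit appeal to
  \<open>TAUT\<close> needs a schematic \<open>pfm\<close> and a substitution.\<close>

primrec beval :: "('p fm \<Rightarrow> bool) \<Rightarrow> 'p fm \<Rightarrow> bool" where
  "beval v (Var p) \<longleftrightarrow> v (Var p)"
| "beval v (Neg \<phi>) \<longleftrightarrow> \<not> beval v \<phi>"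
| "beval v (And \<phi> \<psi>) \<longleftrightarrow> beval v \<phi> \<and> beval v \<psi>"
| "beval v (Dlt \<phi>) \<longleftrightarrow> v (Dlt \<phi>)"

primrec atoms :: "'p fm \<Rightarrow> 'p fm set" where
  "atoms (Var p) = {Var p}"
| "atoms (Neg \<phi>) = atoms \<phi>"
| "atoms (And \<phi> \<psi>) = atoms \<phi> \<union> atoms \<psi>"
| "atoms (Dlt \<phi>) = {Dlt \<phi>}"

primrec skeleton :: "('p fm \<Rightarrow> nat) \<Rightarrow> 'p fm \<Rightarrow> pfm" where
  "skeleton f (Var p) = PVar (f (Var p))"
| "skeleton f (Neg \<phi>) = PNeg (skeleton f \<phi>)"
| "skeleton f (And \<phi> \<psi>) = PAnd (skeleton f \<phi>) (skeleton f \<psi>)"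
| "skeleton f (Dlt \<phi>) = PVar (f (Dlt \<phi>))"

lemma finite_atoms: "finite (atoms \<phi>)"
  by (induction \<phi>) auto

lemma peval_skeleton: "peval w (skeleton f \<phi>) \<longleftrightarrow> beval (w \<circ> f) \<phi>"
  by (induction \<phi>) auto

lemma inst_skeleton: "(\<And>\<alpha>. \<alpha> \<in> atoms \<phi> \<Longrightarrow> \<sigma> (f \<alpha>) = \<alpha>) \<Longrightarrow> inst \<sigma> (skeleton f \<phi>) = \<phi>"
  by (induction \<phi>) auto

text \<open>There may be uncountably many formulas, but a single formula has finitely many atoms, which
  can be numbered injectively. Its skeleton under such a numbering is a tautology of which it is an
  instance.\<close>

lemma K_Delta_if_beval:
  assumes "\<And>v. beval v \<phi>"
  shows "\<phi> \<in> K_Delta"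
proof -
  obtain f :: "'a fm \<Rightarrow> nat" where inj: "inj_on f (atoms \<phi>)"
    using finite_imp_inj_to_nat_seg[OF finite_atoms] by metis
  have "inst (inv_into (atoms \<phi>) f) (skeleton f \<phi>) \<in> K_Delta"
    using assms by (intro TAUT) (simp add: tautology_def peval_skeleton)
  moreover have "inst (inv_into (atoms \<phi>) f) (skeleton f \<phi>) = \<phi>"
    using inj by (intro inst_skeleton) simp
  ultimately show ?thesis by simp
qed

section \<open>Theories and Lindenbaum's lemma\<close>

definition closed_theory :: "'p fm set \<Rightarrow> bool" where
  "closed_theory T \<longleftrightarrow> K_Delta \<subseteq> T \<and> (\<forall>\<phi> \<psi>. \<phi> \<in> T \<longrightarrow> Imp \<phi> \<psi> \<in> T \<longrightarrow> \<psi> \<in> T)"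

lemma K_Delta_subset: "closed_theory T \<Longrightarrow> \<phi> \<in> K_Delta \<Longrightarrow> \<phi> \<in> T"
  unfolding closed_theory_def by (elim conjE) (rule subsetD)

lemma closed_theory_MP: "closed_theory T \<Longrightarrow> Imp \<phi> \<psi> \<in> T \<Longrightarrow> \<phi> \<in> T \<Longrightarrow> \<psi> \<in> T"
  unfolding closed_theory_def by metis

lemma closed_theory_K_Delta: "closed_theory K_Delta"
  unfolding closed_theory_def by (intro conjI subset_refl allI impI) (rule K_Delta.MP)

lemma closed_theory_conseq:
  assumes "closed_theory T" "\<phi> \<in> T" "\<And>v. beval v \<phi> \<Longrightarrow> beval v \<chi>"
  shows "\<chi> \<in> T"
proof -
  have "Imp \<phi> \<chi> \<in> K_Delta"
    using assms(3) by (intro K_Delta_if_beval) auto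
  then show ?thesis
    by (rule closed_theory_MP[OF assms(1) K_Delta_subset[OF assms(1)] assms(2)])
qed

lemma closed_theory_And_iff:
  assumes "closed_theory T"
  shows "And \<phi> \<psi> \<in> T \<longleftrightarrow> \<phi> \<in> T \<and> \<psi> \<in> T"
proof
  assume "And \<phi> \<psi> \<in> T"
  then show "\<phi> \<in> T \<and> \<psi> \<in> T"
    using closed_theory_conseq[OF assms, of "And \<phi> \<psi>"] by auto
next
  assume *: "\<phi> \<in> T \<and> \<psi> \<in> T"
  have "Imp \<psi> (And \<phi> \<psi>) \<in> T"
    by (rule closed_theory_conseq[OF assms conjunct1[OF *]]) auto
  then show "And \<phi> \<psi> \<in> T"
    by (rule closed_theory_MP[OF assms _ conjunct2[OF *]])
qed

lemma closed_theory_conseq2: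
  assumes "closed_theory T" "\<phi> \<in> T" "\<psi> \<in> T" "\<And>v. beval v \<phi> \<Longrightarrow> beval v \<psi> \<Longrightarrow> beval v \<chi>"
  shows "\<chi> \<in> T"
proof (rule closed_theory_conseq[OF assms(1)])
  show "And \<phi> \<psi> \<in> T"
    using assms(1-3) by (simp add: closed_theory_And_iff)
qed (use assms(4) in auto)

text \<open>The deduction theorem in set form: the formulas that \<open>\<alpha>\<close> implies in \<open>T\<close> are the theory
  generated by \<open>T\<close> and \<open>\<alpha>\<close>.\<close>

lemma closed_theory_extend:
  assumes "closed_theory T"
  shows "closed_theory {\<chi>. Imp \<alpha> \<chi> \<in> T}"
  unfolding closed_theory_def
proof (intro conjI subsetI allI impI)
  fix \<phi> :: "'a fm" assume "\<phi> \<in> K_Delta"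
  then have "\<phi> \<in> T"
    by (rule K_Delta_subset[OF assms])
  then have "Imp \<alpha> \<phi> \<in> T"
    by (rule closed_theory_conseq[OF assms]) auto
  then show "\<phi> \<in> {\<chi>. Imp \<alpha> \<chi> \<in> T}" ..
next
  fix \<phi> \<psi> assume "\<phi> \<in> {\<chi>. Imp \<alpha> \<chi> \<in> T}" "Imp \<phi> \<psi> \<in> {\<chi>. Imp \<alpha> \<chi> \<in> T}"
  then have "Imp \<alpha> \<phi> \<in> T" "Imp \<alpha> (Imp \<phi> \<psi>) \<in> T"
    by simp_all
  then have "Imp \<alpha> \<psi> \<in> T"
    by (rule closed_theory_conseq2[OF assms]) auto
  then show "\<psi> \<in> {\<chi>. Imp \<alpha> \<chi> \<in> T}" ..
qed

definition complete_theories :: "'p fm set set" where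
  "complete_theories = {T. closed_theory T \<and> (\<forall>\<phi>. Neg \<phi> \<in> T \<longleftrightarrow> \<phi> \<notin> T)}"

lemma complete_theories_closed: "T \<in> complete_theories \<Longrightarrow> closed_theory T"
  by (simp add: complete_theories_def)

lemma complete_theories_Neg_iff: "T \<in> complete_theories \<Longrightarrow> Neg \<phi> \<in> T \<longleftrightarrow> \<phi> \<notin> T"
  by (simp add: complete_theories_def)

lemma closed_theory_Union_chain:
  assumes chain: "subset.chain \<A> C" and "C \<noteq> {}" and closed: "\<And>U. U \<in> C \<Longrightarrow> closed_theory U"
  shows "closed_theory (\<Union>C)"
  unfolding closed_theory_def
proof (intro conjI allI impI subsetI)
  fix \<phi> :: "'a fm" assume "\<phi> \<in> K_Delta"
  moreover obtain U where "U \<in> C" using \<open>C \<noteq> {}\<close> by auto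
  ultimately show "\<phi> \<in> \<Union>C"
    using K_Delta_subset[OF closed] by blast
next
  fix \<phi> \<psi> assume "\<phi> \<in> \<Union>C" "Imp \<phi> \<psi> \<in> \<Union>C"
  then obtain X Y where XY: "X \<in> C" "\<phi> \<in> X" "Y \<in> C" "Imp \<phi> \<psi> \<in> Y"
    by (elim UnionE)
  moreover have "X \<subseteq> Y \<or> Y \<subseteq> X"
    using chain XY(1,3) by (auto simp: subset_chain_def)
  ultimately obtain U where U: "U \<in> C" "\<phi> \<in> U" "Imp \<phi> \<psi> \<in> U"
    by blast
  then have "\<psi> \<in> U"
    by (intro closed_theory_MP[OF closed[OF U(1)] U(3,2)])
  with U(1) show "\<psi> \<in> \<Union>C" ..
qed

text \<open>Zorn's lemma gives a theory that is maximal among those omitting \<open>\<phi>\<close>. It is complete: if it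
  omitted both \<open>\<psi>\<close> and \<open>Neg \<psi>\<close>, then by maximality both would imply \<open>\<phi>\<close>, and so \<open>\<phi>\<close> would
  follow by cases; if it contained both, it would contain everything.\<close>

lemma Lindenbaum:
  assumes T: "closed_theory T" and \<phi>: "\<phi> \<notin> T"
  obtains M where "M \<in> complete_theories" "T \<subseteq> M" "\<phi> \<notin> M"
proof -
  let ?A = "{U. closed_theory U \<and> (T \<subseteq> U \<and> \<phi> \<notin> U)}"
  have "\<exists>M\<in>?A. \<forall>X\<in>?A. M \<subseteq> X \<longrightarrow> X = M"
  proof (rule subset_Zorn_nonempty)
    show "?A \<noteq> {}" using T \<phi> by blast
  next
    fix C assume C: "C \<noteq> {}" "subset.chain ?A C"
    then have members: "C \<subseteq> ?A"
      by (simp add: subset_chain_def)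
    then have "closed_theory (\<Union>C)"
      by (intro closed_theory_Union_chain[OF C(2,1)]) blast
    moreover have "T \<subseteq> \<Union>C" "\<phi> \<notin> \<Union>C"
      using C(1) members by blast+
    ultimately show "\<Union>C \<in> ?A"
      by simp
  qed
  then obtain M where M: "closed_theory M" "T \<subseteq> M" "\<phi> \<notin> M"
    and max: "\<And>X. closed_theory X \<Longrightarrow> T \<subseteq> X \<Longrightarrow> \<phi> \<notin> X \<Longrightarrow> M \<subseteq> X \<Longrightarrow> X = M"
    by auto
  have omitted: "Imp \<psi> \<phi> \<in> M" if "\<psi> \<notin> M" for \<psi>
  proof (rule ccontr)
    let ?U = "{\<chi>. Imp \<psi> \<chi> \<in> M}"
    assume "Imp \<psi> \<phi> \<notin> M"
    have "M \<subseteq> ?U"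
    proof
      fix \<chi> assume "\<chi> \<in> M"
      then have "Imp \<psi> \<chi> \<in> M"
        by (rule closed_theory_conseq[OF M(1)]) auto
      then show "\<chi> \<in> ?U" ..
    qed
    moreover have "closed_theory ?U"
      using M(1) by (rule closed_theory_extend)
    ultimately have "?U = M"
      using max[of ?U] \<open>Imp \<psi> \<phi> \<notin> M\<close> M(2) by simp
    moreover have "Imp \<psi> \<psi> \<in> M"
      by (rule K_Delta_subset[OF M(1) K_Delta_if_beval]) auto
    ultimately show False
      using that by auto
  qed
  have "Neg \<psi> \<in> M \<longleftrightarrow> \<psi> \<notin> M" for \<psi>
  proof
    assume "Neg \<psi> \<in> M"
    show "\<psi> \<notin> M"
    proof
      assume "\<psi> \<in> M"
      have "\<phi> \<in> M"
        by (rule closed_theory_conseq2[OF M(1) \<open>\<psi> \<in> M\<close> \<open>Neg \<psi> \<in> M\<close>]) auto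
      with M(3) show False ..
    qed
  next
    assume "\<psi> \<notin> M"
    show "Neg \<psi> \<in> M"
    proof (rule ccontr)
      assume "Neg \<psi> \<notin> M"
      have "\<phi> \<in> M"
        by (rule closed_theory_conseq2[OF M(1) omitted[OF \<open>\<psi> \<notin> M\<close>] omitted[OF \<open>Neg \<psi> \<notin> M\<close>]]) auto
      with M(3) show False ..
    qed
  qed
  with M show thesis
    by (intro that) (auto simp: complete_theories_def)
qed

section \<open>Consistent sets are satisfied by complete theories\<close>

lemma sat_inst: "sat (S, N) V s (inst \<sigma> \<alpha>) \<longleftrightarrow> peval (\<lambda>n. sat (S, N) V s (\<sigma> n)) \<alpha>"
  by (induction \<alpha>) auto

text \<open>On a one-point frame in which every set is a neighborhood, each \<open>Dlt \<phi>\<close> is true, so all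
  axioms hold for trivial reasons.\<close>

lemma K_Delta_sound_trivial:
  "\<phi> \<in> K_Delta \<Longrightarrow> sat (UNIV :: unit set, \<lambda>_. UNIV) (\<lambda>_. UNIV) () \<phi>"
  by (induction rule: K_Delta.induct) (auto simp: sat_inst tautology_def)

lemma Neg_Top_notin_K_Delta: "Neg Top \<notin> K_Delta"
  by (auto dest: K_Delta_sound_trivial)

lemma foldl_And_in_closed_theory_iff:
  assumes "closed_theory T"
  shows "foldl And \<gamma> \<gamma>s \<in> T \<longleftrightarrow> set (\<gamma> # \<gamma>s) \<subseteq> T"
  by (induction \<gamma>s arbitrary: \<gamma>) (auto simp: closed_theory_And_iff[OF assms])

text \<open>The consequences of finite conjunctions from \<open>\<Gamma>\<close> are closed under modus ponens because two
  conjunctions can be merged: both are members of the theory generated by the conjunction of the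
  concatenated list. A conjunction has at least one conjunct, hence \<open>\<Gamma> \<noteq> {}\<close>.\<close>

lemma closed_theory_generated:
  assumes "\<Gamma> \<noteq> {}"
  shows "closed_theory {\<chi>. \<exists>\<gamma> \<gamma>s. set (\<gamma> # \<gamma>s) \<subseteq> \<Gamma> \<and> Imp (foldl And \<gamma> \<gamma>s) \<chi> \<in> K_Delta}"
    (is "closed_theory ?T")
  unfolding closed_theory_def
proof (intro conjI subsetI allI impI)
  fix \<phi> :: "'a fm" assume "\<phi> \<in> K_Delta"
  moreover obtain \<gamma> where "\<gamma> \<in> \<Gamma>" using assms by auto
  moreover have "Imp (foldl And \<gamma> []) \<phi> \<in> K_Delta"
    using \<open>\<phi> \<in> K_Delta\<close> by (rule closed_theory_conseq[OF closed_theory_K_Delta]) auto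
  ultimately show "\<phi> \<in> ?T"
    by (intro CollectI exI[of _ \<gamma>] exI[of _ "[]"]) auto
next
  fix \<phi> \<psi> assume "\<phi> \<in> ?T" "Imp \<phi> \<psi> \<in> ?T"
  then obtain \<gamma> \<gamma>s \<delta> \<delta>s where
    \<gamma>: "set (\<gamma> # \<gamma>s) \<subseteq> \<Gamma>" "Imp (foldl And \<gamma> \<gamma>s) \<phi> \<in> K_Delta" and
    \<delta>: "set (\<delta> # \<delta>s) \<subseteq> \<Gamma>" "Imp (foldl And \<delta> \<delta>s) (Imp \<phi> \<psi>) \<in> K_Delta"
    by blast
  define \<beta> where "\<beta> = foldl And \<gamma> (\<gamma>s @ \<delta> # \<delta>s)"
  let ?U = "{\<chi>. Imp \<beta> \<chi> \<in> K_Delta}"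
  have U: "closed_theory ?U"
    by (intro closed_theory_extend closed_theory_K_Delta)
  have "Imp \<beta> \<beta> \<in> K_Delta"
    by (rule K_Delta_if_beval) auto
  then have "foldl And \<gamma> (\<gamma>s @ \<delta> # \<delta>s) \<in> ?U"
    unfolding \<beta>_def[symmetric] ..
  then have "set (\<gamma> # \<gamma>s @ \<delta> # \<delta>s) \<subseteq> ?U"
    unfolding foldl_And_in_closed_theory_iff[OF U] .
  then have *: "foldl And \<gamma> \<gamma>s \<in> ?U" "foldl And \<delta> \<delta>s \<in> ?U"
    unfolding foldl_And_in_closed_theory_iff[OF U] by auto
  have "\<phi> \<in> ?U"
    by (rule closed_theory_MP[OF U K_Delta_subset[OF U \<gamma>(2)] *(1)])
  moreover have "Imp \<phi> \<psi> \<in> ?U"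
    by (rule closed_theory_MP[OF U K_Delta_subset[OF U \<delta>(2)] *(2)])
  ultimately have "\<psi> \<in> ?U"
    by (rule closed_theory_MP[OF U, rotated])
  then have "Imp (foldl And \<gamma> (\<gamma>s @ \<delta> # \<delta>s)) \<psi> \<in> K_Delta"
    by (simp only: \<beta>_def mem_Collect_eq)
  moreover have "set (\<gamma> # \<gamma>s @ \<delta> # \<delta>s) \<subseteq> \<Gamma>"
    using \<gamma>(1) \<delta>(1) by auto
  ultimately show "\<psi> \<in> ?T"
    by blast
qed

lemma consistent_extends_to_complete_theory:
  assumes "consistent K_Delta \<Gamma>"
  obtains M where "M \<in> complete_theories" "\<Gamma> \<subseteq> M"
proof (cases "\<Gamma> = {}")
  case True
  obtain M :: "'a fm set" where "M \<in> complete_theories"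
    by (rule Lindenbaum[OF closed_theory_K_Delta Neg_Top_notin_K_Delta])
  with True show thesis
    using that by simp
next
  case False
  let ?T = "{\<chi>. \<exists>\<gamma> \<gamma>s. set (\<gamma> # \<gamma>s) \<subseteq> \<Gamma> \<and> Imp (foldl And \<gamma> \<gamma>s) \<chi> \<in> K_Delta}"
  have "Neg Top \<notin> ?T"
  proof
    assume "Neg Top \<in> ?T"
    then obtain \<gamma> \<gamma>s where \<gamma>: "set (\<gamma> # \<gamma>s) \<subseteq> \<Gamma>" "Imp (foldl And \<gamma> \<gamma>s) (Neg Top) \<in> K_Delta"
      by blast
    have "Neg (foldl And \<gamma> \<gamma>s) \<in> K_Delta"
      by (rule closed_theory_conseq[OF closed_theory_K_Delta \<gamma>(2)]) auto
    with \<gamma>(1) assms show False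
      unfolding consistent_def by blast
  qed
  then obtain M where M: "M \<in> complete_theories" "?T \<subseteq> M"
    by (rule Lindenbaum[OF closed_theory_generated[OF False]])
  have "\<Gamma> \<subseteq> ?T"
  proof
    fix \<gamma> assume "\<gamma> \<in> \<Gamma>"
    moreover have "Imp (foldl And \<gamma> []) \<gamma> \<in> K_Delta"
      by (rule K_Delta_if_beval) auto
    ultimately show "\<gamma> \<in> ?T"
      by (intro CollectI exI[of _ \<gamma>] exI[of _ "[]"]) auto
  qed
  then have "\<Gamma> \<subseteq> M"
    using M(2) by (rule subset_trans)
  with M(1) show thesis
    by (rule that)
qed

section \<open>The filter of positively settled formulas\<close>

text \<open>All weakenings of \<open>\<phi>\<close> are non-contingent at \<open>T\<close>. For a formula that is non-contingent
  because it is necessary this persists under weakening, whereas for one that is impossible it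
  does not in general; so the definition recovers necessity from \<open>Dlt\<close>.\<close>

definition settled :: "'p fm set \<Rightarrow> 'p fm \<Rightarrow> bool" where
  "settled T \<phi> \<longleftrightarrow> (\<forall>\<psi>. Dlt (Or \<phi> \<psi>) \<in> T)"

lemma Dlt_cong:
  assumes "closed_theory T" "Iff \<phi> \<psi> \<in> K_Delta" "Dlt \<phi> \<in> T"
  shows "Dlt \<psi> \<in> T"
  by (rule closed_theory_conseq2[OF assms(1) assms(3) K_Delta_subset[OF assms(1) RE[OF assms(2)]]])
    auto

text \<open>A weakening of \<open>\<psi>\<close> is, up to provable equivalence, a weakening of \<open>\<phi>\<close>.\<close>

lemma settled_mono:
  assumes T: "closed_theory T" and imp: "Imp \<phi> \<psi> \<in> K_Delta" and \<phi>: "settled T \<phi>"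
  shows "settled T \<psi>"
  unfolding settled_def
proof
  fix \<chi>
  have "Iff (Or \<phi> (Or \<psi> \<chi>)) (Or \<psi> \<chi>) \<in> K_Delta"
    by (rule closed_theory_conseq[OF closed_theory_K_Delta imp]) auto
  then show "Dlt (Or \<psi> \<chi>) \<in> T"
    by (rule Dlt_cong[OF T]) (use \<phi> in \<open>simp add: settled_def\<close>)
qed

text \<open>A weakening of the conjunction is the conjunction of weakenings, so that axiom C applies.\<close>

lemma settled_And:
  assumes T: "closed_theory T" and "settled T \<phi>" "settled T \<psi>"
  shows "settled T (And \<phi> \<psi>)"
  unfolding settled_def
proof
  fix \<chi>
  have "And (Dlt (Or \<phi> \<chi>)) (Dlt (Or \<psi> \<chi>)) \<in> T"
    using assms(2,3) by (simp add: closed_theory_And_iff[OF T] settled_def)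
  then have "Dlt (And (Or \<phi> \<chi>) (Or \<psi> \<chi>)) \<in> T"
    by (rule closed_theory_MP[OF T K_Delta_subset[OF T C]])
  then show "Dlt (Or (And \<phi> \<psi>) \<chi>) \<in> T"
    by (rule Dlt_cong[OF T, rotated]) (rule K_Delta_if_beval, auto)
qed

lemma settled_Top:
  assumes T: "closed_theory T"
  shows "settled T Top"
  unfolding settled_def
proof
  fix \<chi> :: "'a fm"
  show "Dlt (Or Top \<chi>) \<in> T"
    by (rule Dlt_cong[OF T _ K_Delta_subset[OF T N]]) (rule K_Delta_if_beval, auto)
qed

lemma Dlt_if_settled:
  assumes T: "closed_theory T" and "settled T \<phi>"
  shows "Dlt \<phi> \<in> T"
proof (rule Dlt_cong[OF T])
  show "Dlt (Or \<phi> \<phi>) \<in> T"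
    using assms(2) by (simp add: settled_def)
  show "Iff (Or \<phi> \<phi>) \<phi> \<in> K_Delta"
    by (rule K_Delta_if_beval) auto
qed

text \<open>If neither \<open>\<phi>\<close> nor \<open>Neg \<phi>\<close> were settled, there would be weakenings \<open>Or \<phi> \<psi>\<close> and
  \<open>Or (Neg \<phi>) \<chi>\<close> that are both contingent at \<open>T\<close>, against the instance of axiom M for this \<open>\<psi>\<close>
  and \<open>\<chi>\<close>. Since \<open>T\<close> is complete, it contains one of the disjuncts of that instance.\<close>

lemma Dlt_iff_settled:
  assumes "T \<in> complete_theories"
  shows "Dlt \<phi> \<in> T \<longleftrightarrow> settled T \<phi> \<or> settled T (Neg \<phi>)"
proof
  note T = complete_theories_closed[OF assms]
  {
    assume "Dlt \<phi> \<in> T"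
    then have "Or (Dlt (Or \<phi> \<psi>)) (Dlt (Or (Neg \<phi>) \<chi>)) \<in> T" for \<psi> \<chi>
      by (rule closed_theory_MP[OF T K_Delta_subset[OF T M]])
    then show "settled T \<phi> \<or> settled T (Neg \<phi>)"
      by (auto simp: settled_def complete_theories_Neg_iff[OF assms] closed_theory_And_iff[OF T])
  next
    assume "settled T \<phi> \<or> settled T (Neg \<phi>)"
    then have "Dlt \<phi> \<in> T \<or> Dlt (Neg \<phi>) \<in> T"
      using Dlt_if_settled[OF T] by blast
    moreover have "Imp (Dlt (Neg \<phi>)) (Dlt \<phi>) \<in> T"
      using K_Delta_subset[OF T Equ[of \<phi>]] by (simp add: closed_theory_And_iff[OF T])
    ultimately show "Dlt \<phi> \<in> T"
      using closed_theory_MP[OF T, of "Dlt (Neg \<phi>)" "Dlt \<phi>"] by blast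
  }
qed

section \<open>The canonical model\<close>

definition truth_set :: "'p fm \<Rightarrow> 'p fm set set" where
  "truth_set \<phi> = {T \<in> complete_theories. \<phi> \<in> T}"

definition nbhds :: "'p fm set \<Rightarrow> 'p fm set set set" where
  "nbhds T = {X. X \<subseteq> complete_theories \<and> (\<exists>\<phi>. settled T \<phi> \<and> truth_set \<phi> \<subseteq> X)}"

lemma truth_set_subset_iff: "truth_set \<phi> \<subseteq> truth_set \<psi> \<longleftrightarrow> Imp \<phi> \<psi> \<in> K_Delta"
proof
  assume sub: "truth_set \<phi> \<subseteq> truth_set \<psi>"
  show "Imp \<phi> \<psi> \<in> K_Delta"
  proof (rule ccontr)
    let ?U = "{\<chi>. Imp \<phi> \<chi> \<in> K_Delta}"
    assume "Imp \<phi> \<psi> \<notin> K_Delta"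
    then have "\<psi> \<notin> ?U"
      by simp
    then obtain M where M: "M \<in> complete_theories" "?U \<subseteq> M" "\<psi> \<notin> M"
      by (rule Lindenbaum[OF closed_theory_extend[OF closed_theory_K_Delta]])
    have "Imp \<phi> \<phi> \<in> K_Delta"
      by (rule K_Delta_if_beval) auto
    with M sub show False
      by (auto simp: truth_set_def)
  qed
next
  assume "Imp \<phi> \<psi> \<in> K_Delta"
  then have "\<psi> \<in> T" if "T \<in> complete_theories" "\<phi> \<in> T" for T
    using closed_theory_MP[of T \<phi> \<psi>] K_Delta_subset complete_theories_closed that by blast
  then show "truth_set \<phi> \<subseteq> truth_set \<psi>"
    by (auto simp: truth_set_def)
qed

lemma truth_set_in_nbhds_iff:
  assumes "T \<in> complete_theories"
  shows "truth_set \<phi> \<in> nbhds T \<longleftrightarrow> settled T \<phi>"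
proof
  assume "truth_set \<phi> \<in> nbhds T"
  then obtain \<psi> where "settled T \<psi>" "truth_set \<psi> \<subseteq> truth_set \<phi>"
    by (auto simp: nbhds_def)
  then show "settled T \<phi>"
    unfolding truth_set_subset_iff
    using settled_mono[OF complete_theories_closed[OF assms]] by blast
next
  assume "settled T \<phi>"
  then show "truth_set \<phi> \<in> nbhds T"
    by (auto simp: nbhds_def truth_set_def)
qed

lemma truth_set_Neg: "truth_set (Neg \<phi>) = complete_theories - truth_set \<phi>"
  by (auto simp: truth_set_def complete_theories_Neg_iff)

lemma truth_set_And: "truth_set (And \<phi> \<psi>) = truth_set \<phi> \<inter> truth_set \<psi>"
  by (auto simp: truth_set_def closed_theory_And_iff[OF complete_theories_closed])

lemma nbhds_Int:
  assumes "T \<in> complete_theories" "X \<in> nbhds T" "Y \<in> nbhds T"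
  shows "X \<inter> Y \<in> nbhds T"
proof -
  obtain \<phi> \<psi> where *: "settled T \<phi>" "truth_set \<phi> \<subseteq> X" "settled T \<psi>" "truth_set \<psi> \<subseteq> Y"
    using assms(2,3) by (auto simp: nbhds_def)
  have "settled T (And \<phi> \<psi>)"
    using * by (intro settled_And complete_theories_closed assms(1))
  moreover have "truth_set (And \<phi> \<psi>) \<subseteq> X \<inter> Y"
    using * by (auto simp: truth_set_And)
  ultimately show ?thesis
    using assms(2) by (auto simp: nbhds_def)
qed

lemma canonical_frame_in_filters:
  assumes "complete_theories \<noteq> ({} :: 'p fm set set)"
  shows "(complete_theories :: 'p fm set set, nbhds) \<in> filters"
proof -
  let ?F = "(complete_theories :: 'p fm set set, nbhds)"
  have "nbhd_frame ?F"
    using assms by (auto simp: nbhd_frame_def nbhds_def)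
  moreover have "prop_m ?F"
    unfolding prop_m_def nbhds_def by blast
  moreover have "prop_c ?F"
    by (simp add: prop_c_def nbhds_Int)
  moreover have "prop_n ?F"
    using settled_Top[OF complete_theories_closed]
    unfolding prop_n_def nbhds_def truth_set_def by blast
  ultimately show ?thesis
    by (simp add: filters_def)
qed

lemma truth_lemma:
  assumes "T \<in> complete_theories"
  shows "sat (complete_theories, nbhds) (\<lambda>p. truth_set (Var p)) T \<phi> \<longleftrightarrow> \<phi> \<in> T"
  using assms
proof (induction \<phi> arbitrary: T)
  case (Var p)
  then show ?case by (simp add: truth_set_def)
next
  case (Neg \<phi>)
  then show ?case by (simp add: complete_theories_Neg_iff)
next
  case (And \<phi> \<psi>)
  then show ?case by (simp add: closed_theory_And_iff[OF complete_theories_closed])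
next
  case (Dlt \<phi>)
  have "{U \<in> complete_theories. sat (complete_theories, nbhds) (\<lambda>p. truth_set (Var p)) U \<phi>}
      = truth_set \<phi>"
    using Dlt.IH by (auto simp: truth_set_def)
  then have "sat (complete_theories, nbhds) (\<lambda>p. truth_set (Var p)) T (Dlt \<phi>)
      \<longleftrightarrow> truth_set \<phi> \<in> nbhds T \<or> truth_set (Neg \<phi>) \<in> nbhds T"
    by (simp add: truth_set_Neg)
  then show ?case
    using Dlt.prems by (simp only: truth_set_in_nbhds_iff Dlt_iff_settled)
qed

theorem theorem22:
  shows "strongly_complete (K_Delta :: 'p fm set) (filters :: 'p fm set frame set)"
  unfolding strongly_complete_def
proof (intro allI impI)
  fix \<Gamma> :: "'p fm set" assume "consistent K_Delta \<Gamma>"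
  then obtain T where T: "T \<in> complete_theories" "\<Gamma> \<subseteq> T"
    by (rule consistent_extends_to_complete_theory)
  have "(complete_theories :: 'p fm set set, nbhds) \<in> filters"
    using T(1) by (intro canonical_frame_in_filters) blast
  moreover have "valuation_on complete_theories (\<lambda>p :: 'p. truth_set (Var p))"
    by (auto simp: valuation_on_def truth_set_def)
  moreover have "\<forall>\<gamma>\<in>\<Gamma>. sat (complete_theories, nbhds) (\<lambda>p. truth_set (Var p)) T \<gamma>"
    using T(2) truth_lemma[OF T(1)] by blast
  ultimately show "\<exists>S N V s. (S, N) \<in> (filters :: 'p fm set frame set) \<and> valuation_on S V \<and> s \<in> S \<and>
      (\<forall>\<gamma>\<in>\<Gamma>. sat (S, N) V s \<gamma>)"
    using T(1) by (intro exI conjI)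
qed

end
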